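(* Let $L$ be a (finite) lattice, $F$ a subconfluence of $L$ with associated interior operators $\{p_t\}_{t\in F}$, $O$ a finite set of objects described as elements of $L$ by a map $d:O\to L$, and $A=p_A[2^O]$ an abstraction of $2^O$ with associated interior operator $p_A$. Define, for $t\in F$, $$f_A(t)=p_t\circ \mathrm{int}\circ p_A\circ \mathrm{ext}(t),$$ where $(\mathrm{int}, p_A\circ\mathrm{ext})$ is a Galois connection on $(A,L)$. Then $f_A$ is a support closure operator on $F$ with respect to $A$, and $f_A[F]$ is a confluence.
   Context: All ordered sets are finite. For an ordered set $E$ and $t\in E$: $E^t=\{x\in E: x\ge t\}$, $E_t=\{x\in E: x\le t\}$. A (finite) ordered set $F$ is a confluence if for every $t\in F$, $F^t$ is a meet-semilattice with a greatest element (hence, by finiteness, a lattice). A subset $F$ of a lattice $L$ is a subconfluence of $L$ if, with the induced order, $F$ is a confluence and for all $t\in F$ and $x,y\in F^t$ the join of $x,y$ in $F^t$ equals their join $x\vee y$ in $L$. For $t\in F$ the associated interior operator $p_t:L^t\to L^t$ is $p_t(x)=\bigvee_{q\in F^t\cap L_x} q$ (join in $L$); it has range $F^t$. An interior operator is a monotone, idempotent, intensive ($p(x)\le x$) self-map; a closure operator is a monotone, idempotent, extensive ($f(x)\ge x$) self-map. An abstraction of a lattice $T$ is a subset $A\subseteq T$ closed under joins of arbitrary subsets (including the empty one, so $\bot_T\in A$); its associated interior operator, whose range is $A$, is $p_A(x)=\bigvee_{a\in A\cap T_x}a$; here $T=2^O$ ordered by inclusion, so $p_A(e)=\bigcup_{a\in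 A,\,a\subseteq e}a$. A Galois connection on $(X,L)$ is a pair of order-reversing maps $\mathrm{i}:X\to L$, $\mathrm{e}:L\to X$ with $\mathrm{e}\circ\mathrm{i}(x)\ge x$ and $\mathrm{i}\circ\mathrm{e}(l)\ge l$ for all $x\in X$, $l\in L$. For $t\in L$, $\mathrm{ext}(t)=\{o\in O: d(o)\ge t\}$ is the support set of $t$; for $e\subseteq O$, $\mathrm{int}(e)=\bigwedge_{o\in e} d(o)$ (with $\mathrm{int}(\emptyset)=\top_L$). The abstract support set of $t$ is $\mathrm{ext}_A(t)=p_A\circ\mathrm{ext}(t)$. A support closure operator on $F$ with respect to $A$ is a closure operator $f$ on $F$ such that for every $t\in F$, $f(t)$ is the greatest element of $\{u\in F: u\ge t,\ \mathrm{ext}_A(u)=\mathrm{ext}_A(t)\}$. *)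

theory Defs
  imports "HOL-Library.FuncSet" "HOL-Library.Lub_Glb"
begin

definition upper_part :: "'a::order set \<Rightarrow> 'a \<Rightarrow> 'a set" where
  "upper_part E t = {x \<in> E. t \<le> x}"

definition lower_part :: "'a::order set \<Rightarrow> 'a \<Rightarrow> 'a set" where
  "lower_part E t = {x \<in> E. x \<le> t}"

text \<open>Subsets carry the induced order; the meets below are those of
  \<^term>\<open>upper_part F t\<close> itself, not of the ambient type.\<close>

definition meet_semilattice_with_top :: "'a::order set \<Rightarrow> bool" where
  "meet_semilattice_with_top S \<longleftrightarrow>
     (\<forall>x\<in>S. \<forall>y\<in>S. \<exists>m. isGlb S {x, y} m) \<and> (\<exists>g. greatestP (\<lambda>x. x \<in> S) g)"

definition confluence :: "'a::order set \<Rightarrow> bool" where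
  "confluence F \<longleftrightarrow> finite F \<and> (\<forall>t\<in>F. meet_semilattice_with_top (upper_part F t))"

text \<open>The ambient lattice is the whole type. Throughout, \<^class>\<open>complete_lattice\<close> together
  with \<^class>\<open>finite\<close> stands for a finite (nonempty) lattice: completeness is then automatic
  and merely makes \<open>Sup\<close>, \<open>Inf\<close> and \<open>top\<close> available.\<close>

definition subconfluence :: "'a::lattice set \<Rightarrow> bool" where
  "subconfluence F \<longleftrightarrow> confluence F \<and>
     (\<forall>t\<in>F. \<forall>x\<in>upper_part F t. \<forall>y\<in>upper_part F t. isLub (upper_part F t) {x, y} (sup x y))"

definition conf_interior :: "'a::complete_lattice set \<Rightarrow> 'a \<Rightarrow> 'a \<Rightarrow> 'a" where
  "conf_interior F t x = Sup (upper_part F t \<inter> lower_part UNIV x)"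

definition closure_operator_on :: "'a::order set \<Rightarrow> ('a \<Rightarrow> 'a) \<Rightarrow> bool" where
  "closure_operator_on E f \<longleftrightarrow>
     f \<in> E \<rightarrow> E \<and> mono_on E f \<and> (\<forall>x\<in>E. f (f x) = f x) \<and> (\<forall>x\<in>E. x \<le> f x)"

definition galois_connection_on ::
    "'a::order set \<Rightarrow> 'b::order set \<Rightarrow> ('a \<Rightarrow> 'b) \<Rightarrow> ('b \<Rightarrow> 'a) \<Rightarrow> bool" where
  "galois_connection_on X L i e \<longleftrightarrow>
     i \<in> X \<rightarrow> L \<and> e \<in> L \<rightarrow> X \<and> antimono_on X i \<and> antimono_on L e \<and>
     (\<forall>x\<in>X. x \<le> e (i x)) \<and> (\<forall>l\<in>L. l \<le> i (e l))"

text \<open>Joins in the powerset lattice \<^term>\<open>Pow Ob\<close> are unions; the case \<open>S = {}\<close> gives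
  \<^term>\<open>{} \<in> A\<close>.\<close>

definition abstraction :: "'o set \<Rightarrow> 'o set set \<Rightarrow> bool" where
  "abstraction Ob A \<longleftrightarrow> A \<subseteq> Pow Ob \<and> (\<forall>S. S \<subseteq> A \<longrightarrow> \<Union>S \<in> A)"

definition abs_interior :: "'o set set \<Rightarrow> 'o set \<Rightarrow> 'o set" where
  "abs_interior A e = \<Union>(A \<inter> lower_part UNIV e)"

definition support_set :: "'o set \<Rightarrow> ('o \<Rightarrow> 'a::order) \<Rightarrow> 'a \<Rightarrow> 'o set" where
  "support_set Ob d t = {o' \<in> Ob. t \<le> d o'}"

definition intent :: "('o \<Rightarrow> 'a::complete_lattice) \<Rightarrow> 'o set \<Rightarrow> 'a" where
  "intent d e = (INF o'\<in>e. d o')"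

definition abs_support_set ::
    "'o set \<Rightarrow> ('o \<Rightarrow> 'a::order) \<Rightarrow> 'o set set \<Rightarrow> 'a \<Rightarrow> 'o set" where
  "abs_support_set Ob d A t = abs_interior A (support_set Ob d t)"

definition support_closure_operator ::
    "'o set \<Rightarrow> ('o \<Rightarrow> 'a::order) \<Rightarrow> 'o set set \<Rightarrow> 'a set \<Rightarrow> ('a \<Rightarrow> 'a) \<Rightarrow> bool" where
  "support_closure_operator Ob d A F f \<longleftrightarrow> closure_operator_on F f \<and>
     (\<forall>t\<in>F. greatestP
        (\<lambda>u. u \<in> F \<and> t \<le> u \<and> abs_support_set Ob d A u = abs_support_set Ob d A t) (f t))"

definition abs_closure ::
    "'o set \<Rightarrow> ('o \<Rightarrow> 'a::complete_lattice) \<Rightarrow> 'o set set \<Rightarrow> 'a set \<Rightarrow> 'a \<Rightarrow> 'a" where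
  "abs_closure Ob d A F t = conf_interior F t (intent d (abs_interior A (support_set Ob d t)))"

lemma abs_interior_range:
  assumes "abstraction Ob A"
  shows "abs_interior A ` Pow Ob = A"
proof
  show "abs_interior A ` Pow Ob \<subseteq> A"
    using assms by (auto simp: abs_interior_def abstraction_def)
  show "A \<subseteq> abs_interior A ` Pow Ob"
  proof
    fix a assume "a \<in> A"
    then have "abs_interior A a = a" "a \<in> Pow Ob"
      using assms by (auto simp: abs_interior_def lower_part_def abstraction_def)
    then show "a \<in> abs_interior A ` Pow Ob" by (metis image_eqI)
  qed
qed

end

theory Submission
  imports Defs
begin

text \<open>The map \<open>C = intent \<circ> abs_support_set\<close> is the closure operator on the ambient lattice given
  by the Galois connection, and the abstract closure \<open>f t\<close> is the greatest element of \<open>F\<close> between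
  \<open>t\<close> and \<open>C t\<close>. Monotonicity is the only point where this needs more than \<open>C\<close> itself: for
  \<open>t \<le> u\<close> in \<open>F\<close>, the join of \<open>f t\<close> and \<open>u\<close> is still in \<open>F\<close> and below \<open>C u\<close>, hence below \<open>f u\<close>.
  Finally, meets and greatest elements of up-sets are fixed by any closure operator that
  fixes the elements they are formed from.\<close>

lemma greatestP_iff: "greatestP P x \<longleftrightarrow> P x \<and> (\<forall>y. P y \<longrightarrow> y \<le> x)"
  by (auto simp: greatestP_def setle_def)

lemma isGlb_pair_iff:
  "isGlb S {x, y} m \<longleftrightarrow>
     m \<in> S \<and> m \<le> x \<and> m \<le> y \<and> (\<forall>z\<in>S. z \<le> x \<longrightarrow> z \<le> y \<longrightarrow> z \<le> m)"
  by (auto simp: isGlb_def isLb_def setge_def greatestP_iff)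

lemma closure_operator_onD:
  assumes "closure_operator_on E f"
  shows "x \<in> E \<Longrightarrow> f x \<in> E"
    and "x \<in> E \<Longrightarrow> y \<in> E \<Longrightarrow> x \<le> y \<Longrightarrow> f x \<le> f y"
    and "x \<in> E \<Longrightarrow> f (f x) = f x"
    and "x \<in> E \<Longrightarrow> x \<le> f x"
  using assms by (auto simp: closure_operator_on_def dest: mono_onD)

lemma confluence_closure_image:
  assumes F: "confluence F" and f: "closure_operator_on F f"
  shows "confluence (f ` F)"
  unfolding confluence_def
proof (intro conjI ballI)
  note f = closure_operator_onD[OF f]
  show "finite (f ` F)"
    using F by (simp add: confluence_def)
  fix t assume t: "t \<in> f ` F"
  then have tF: "t \<in> F" using f(1) by auto
  \<comment> \<open>By idempotence, the elements of the image are fixed points of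
    \<open>f\<close>.\<close>
  have fix_image: "f x = x" "x \<in> F" if "x \<in> f ` F" for x
    using that f(1,3) by auto
  have S: "meet_semilattice_with_top (upper_part F t)"
    using F tF by (auto simp: confluence_def)
  show "meet_semilattice_with_top (upper_part (f ` F) t)"
    unfolding meet_semilattice_with_top_def
  proof (intro conjI ballI)
    fix x y assume x: "x \<in> upper_part (f ` F) t" and y: "y \<in> upper_part (f ` F) t"
    then have xy: "x \<in> f ` F" "y \<in> f ` F" "t \<le> x" "t \<le> y"
      by (auto simp: upper_part_def)
    then have "x \<in> upper_part F t" "y \<in> upper_part F t"
      using fix_image(2) by (auto simp: upper_part_def)
    then obtain m where m: "isGlb (upper_part F t) {x, y} m"
      using S by (auto simp: meet_semilattice_with_top_def)
    then have mF: "m \<in> F" "t \<le> m" "m \<le> x" "m \<le> y"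
      by (auto simp: isGlb_pair_iff upper_part_def)
    \<comment> \<open>Monotonicity gives \<open>f m \<le> f x = x\<close>, and likewise for
      \<open>y\<close>. So \<open>f m\<close> is a lower bound lying above the meet
      \<open>m\<close>, hence it is itself the meet.\<close>
    have "f m \<le> x" "f m \<le> y"
      using f(2)[OF mF(1)] fix_image xy mF by metis+
    then have "isGlb (upper_part (f ` F) t) {x, y} (f m)"
      using m mF f(4)[OF mF(1)] fix_image(2)
      unfolding isGlb_pair_iff upper_part_def by (auto 4 3 intro: order_trans)
    then show "\<exists>m. isGlb (upper_part (f ` F) t) {x, y} m" ..
  next
    obtain g where g: "greatestP (\<lambda>x. x \<in> upper_part F t) g"
      using S by (auto simp: meet_semilattice_with_top_def)
    then have gF: "g \<in> F" "t \<le> g"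
      by (auto simp: greatestP_iff upper_part_def)
    then have "greatestP (\<lambda>x. x \<in> upper_part (f ` F) t) (f g)"
      using g f(4)[OF gF(1)] fix_image(2)
      unfolding greatestP_iff upper_part_def by (auto 4 3 intro: order_trans)
    then show "\<exists>g. greatestP (\<lambda>x. x \<in> upper_part (f ` F) t) g" ..
  qed
qed

text \<open>A lub in \<open>upper_part F t\<close> belongs to that set. The common lower bound
  \<open>t\<close> in \<open>F\<close> matters: \<open>F\<close> as a whole may fail to be closed
  under joins.\<close>

lemma subconfluence_sup_closed:
  assumes "subconfluence F" "t \<in> F" "x \<in> F" "y \<in> F" "t \<le> x" "t \<le> y"
  shows "sup x y \<in> F"
proof -
  have "isLub (upper_part F t) {x, y} (sup x y)"
    using assms by (auto simp: subconfluence_def upper_part_def)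
  then show ?thesis
    by (simp add: upper_part_def isLub_def leastP_def isUb_def)
qed

text \<open>A finite nonempty set closed under binary joins contains its supremum. The assumption
  \<open>t \<le> c\<close> puts \<open>t\<close> into the set, so the supremum is not that of the
  empty set.\<close>

lemma conf_interior_greatest:
  fixes F :: "'a::complete_lattice set"
  assumes F: "subconfluence F" and "t \<in> F" "t \<le> c"
  shows "greatestP (\<lambda>u. u \<in> F \<and> t \<le> u \<and> u \<le> c) (conf_interior F t c)"
proof -
  define S where "S = {u \<in> F. t \<le> u \<and> u \<le> c}"
  have eq: "conf_interior F t c = Sup S"
    unfolding conf_interior_def S_def upper_part_def lower_part_def
    by (rule arg_cong[of _ _ Sup]) auto
  have "finite S" "S \<noteq> {}"
    using assms by (auto simp: S_def subconfluence_def confluence_def)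
  moreover have "sup x y \<in> S" if "x \<in> S" "y \<in> S" for x y
    using that subconfluence_sup_closed[OF F \<open>t \<in> F\<close>] by (auto simp: S_def intro: le_supI1)
  ultimately have "Sup S \<in> S"
    by (intro finite_Sup_in)
  then show ?thesis
    unfolding eq by (auto simp: greatestP_iff S_def intro: Sup_upper)
qed

lemma galois_connection_intent:
  fixes d :: "'o \<Rightarrow> 'a::complete_lattice"
  assumes "abstraction Ob A"
  shows "galois_connection_on A UNIV (intent d) (abs_interior A \<circ> support_set Ob d)"
  unfolding galois_connection_on_def
proof (intro conjI ballI)
  show "abs_interior A \<circ> support_set Ob d \<in> UNIV \<rightarrow> A"
    using assms by (auto simp: abstraction_def abs_interior_def)
  show "antimono_on A (intent d)"
    by (auto simp: monotone_on_def intent_def intro: INF_superset_mono)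
  show "antimono_on UNIV (abs_interior A \<circ> support_set Ob d)"
  proof (rule monotone_onI)
    fix t u :: 'a assume "t \<le> u"
    then have "support_set Ob d u \<subseteq> support_set Ob d t"
      by (auto simp: support_set_def)
    then have "A \<inter> lower_part UNIV (support_set Ob d u) \<subseteq> A \<inter> lower_part UNIV (support_set Ob d t)"
      by (auto simp: lower_part_def)
    then show "(abs_interior A \<circ> support_set Ob d) u \<subseteq> (abs_interior A \<circ> support_set Ob d) t"
      unfolding abs_interior_def comp_apply by (rule Union_mono)
  qed
  show "x \<subseteq> (abs_interior A \<circ> support_set Ob d) (intent d x)" if "x \<in> A" for x
  proof -
    have "x \<subseteq> support_set Ob d (intent d x)"
      using that assms by (auto simp: abstraction_def support_set_def intent_def intro: INF_lower)
    \<comment> \<open>Since \<open>x \<in> A\<close>, it is one of the sets whose union is the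
      abstract interior.\<close>
    then show ?thesis
      using that by (auto simp: abs_interior_def lower_part_def)
  qed
  \<comment> \<open>The interior only removes objects from the support set of \<open>l\<close>, and
    every remaining description is still above \<open>l\<close>.\<close>
  show "l \<le> intent d ((abs_interior A \<circ> support_set Ob d) l)" for l
    by (auto simp: intent_def abs_interior_def lower_part_def support_set_def intro!: INF_greatest)
qed simp_all

text \<open>\<open>e (i (e t)) = e t\<close> is what makes the fibre of \<open>e\<close> above \<open>t\<close> an interval with top \<open>i (e t)\<close>.\<close>

lemma galois_connection_fibre:
  assumes "galois_connection_on X UNIV i e" and "t \<le> u"
  shows "e u = e t \<longleftrightarrow> u \<le> i (e t)"
proof
  show "e u = e t \<Longrightarrow> u \<le> i (e t)"
    using assms by (metis UNIV_I galois_connection_on_def)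
next
  assume "u \<le> i (e t)"
  have X: "e t \<in> X" "e t \<le> e (i (e t))" and anti: "antimono_on UNIV e"
    using assms by (auto simp: galois_connection_on_def)
  have "e (i (e t)) \<le> e u" "e u \<le> e t"
    using anti \<open>u \<le> i (e t)\<close> \<open>t \<le> u\<close> by (auto simp: monotone_on_def)
  with X show "e u = e t" by order
qed

lemma closure_operator_on_fibre_top:
  fixes F :: "'a::lattice set"
  assumes F: "subconfluence F" and G: "galois_connection_on X UNIV i e"
    and f: "\<And>t. t \<in> F \<Longrightarrow> greatestP (\<lambda>u. u \<in> F \<and> t \<le> u \<and> e u = e t) (f t)"
  shows "closure_operator_on F f"
proof -
  have f': "f t \<in> F" "t \<le> f t" "e (f t) = e t" "\<And>u. u \<in> F \<Longrightarrow> t \<le> u \<Longrightarrow> e u = e t \<Longrightarrow> u \<le> f t"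
    if "t \<in> F" for t
    using f[OF that] by (auto simp: greatestP_iff)
  have "f (f t) = f t" if "t \<in> F" for t
  proof -
    note ft = f'[OF f'(1)[OF that]]
    \<comment> \<open>\<open>f (f t)\<close> lies in the fibre of \<open>t\<close>, whose greatest
      element is \<open>f t\<close>.\<close>
    have "t \<le> f (f t)" "e (f (f t)) = e t"
      using ft f'(2,3)[OF that] by (auto intro: order_trans)
    then show ?thesis
      using ft f'(4)[OF that] by (auto intro: antisym)
  qed
  moreover have "f t \<le> f u" if "t \<in> F" "u \<in> F" "t \<le> u" for t u
  proof -
    have "sup (f t) u \<in> F"
      using that f' by (intro subconfluence_sup_closed[OF F, of t])
    \<comment> \<open>\<open>i \<circ> e\<close> is monotone, being composed of two antitone maps.
      It bounds \<open>f t \<le> i (e t)\<close> by \<open>i (e u)\<close>, which also bounds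
      \<open>u\<close>; the join is therefore in the fibre of \<open>u\<close>.\<close>
    moreover have "i (e t) \<le> i (e u)"
      using G \<open>t \<le> u\<close> unfolding galois_connection_on_def monotone_on_def by blast
    then have "sup (f t) u \<le> i (e u)"
      using G f'(3)[OF that(1)] galois_connection_fibre[OF G f'(2)[OF that(1)]]
        galois_connection_fibre[OF G order_refl, of u] by (auto intro: order_trans)
    then have "e (sup (f t) u) = e u"
      by (simp add: galois_connection_fibre[OF G])
    ultimately show ?thesis
      using f'(4)[OF that(2), of "sup (f t) u"] by simp
  qed
  ultimately show ?thesis
    using f' by (auto simp: closure_operator_on_def intro: mono_onI)
qed

theorem theorem4:
  fixes F :: "'l::{finite, complete_lattice} set"
    and Ob :: "'o set"
    and d :: "'o \<Rightarrow> 'l"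
    and A :: "'o set set"
  assumes "subconfluence F"
    and "finite Ob"
    and "abstraction Ob A"
  shows "galois_connection_on A UNIV (intent d) (abs_interior A \<circ> support_set Ob d) \<and>
    support_closure_operator Ob d A F (abs_closure Ob d A F) \<and>
    confluence (abs_closure Ob d A F ` F)"
proof -
  let ?e = "abs_interior A \<circ> support_set Ob d"
  have G: "galois_connection_on A UNIV (intent d) ?e"
    using assms(3) by (rule galois_connection_intent)
  have top: "greatestP (\<lambda>u. u \<in> F \<and> t \<le> u \<and> ?e u = ?e t) (abs_closure Ob d A F t)"
    if "t \<in> F" for t
  proof -
    have "t \<le> intent d (?e t)"
      using G by (auto simp: galois_connection_on_def)
    \<comment> \<open>With \<open>c = intent d (?e t)\<close>, the fibre lemma turns the bound
      \<open>u \<le> c\<close> into equality of abstract support sets.\<close>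
    from conf_interior_greatest[OF assms(1) that this] show ?thesis
      using galois_connection_fibre[OF G] by (auto simp: abs_closure_def greatestP_iff)
  qed
  have C: "closure_operator_on F (abs_closure Ob d A F)"
    using closure_operator_on_fibre_top[OF assms(1) G top] .
  moreover have "confluence (abs_closure Ob d A F ` F)"
    using assms(1) C by (auto simp: subconfluence_def intro: confluence_closure_image)
  ultimately show ?thesis
    using G top by (simp add: support_closure_operator_def abs_support_set_def)
qed

end
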